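(* Let $V\in L^\infty(\Omega)$ with $V\ge 0$ and let $f\in L^1(\Omega)$. There exists at most one function $u\in L^1(\Omega)$ such that $Vu\in L^1(\Omega)$ and $u=\mathcal G(f-Vu)$.
   Context: Setting: $n\ge 3$, $0<s\le 1$, $0<\gamma\le 1$, $\Omega\subset\mathbb R^n$ is a bounded domain, $\delta(x)=\mathrm{dist}(x,\partial\Omega)$. The Green operator is $\mathcal G(f)(x)=\int_\Omega \mathbb G(x,y)f(y)\,dy$, where the kernel $\mathbb G\ge 0$ on $\Omega\times\Omega$ satisfies: (G1) $\mathbb G(x,y)=\mathbb G(y,x)$; (G2) there are constants $0<c\le C$ with $c\,K(x,y)\le \mathbb G(x,y)\le C\,K(x,y)$, where $K(x,y)=\frac{1}{|x-y|^{n-2s}}\left(\min\left\{\frac{\delta(x)\delta(y)}{|x-y|^2},1\right\}\right)^\gamma$; (G3) $\int_\Omega f\,\mathcal G(f)\,dx\ge 0$ for all $f\in L^2(\Omega)$; (G4) $\mathcal G$ maps $L^\infty(\Omega)$ into $\mathcal C(\overline\Omega)$. *)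

theory Defs
  imports "HOL-Analysis.Analysis"
begin

text \<open>
  Elements of \<open>L\<^sup>p(\<Omega>)\<close> are represented by functions, identified up to equality almost everywhere;
  \<open>L\<^sup>1(\<Omega>)\<close> is \<open>integrable (lebesgue_on \<Omega>)\<close>.
\<close>

definition L2_on :: "(real^'n) set \<Rightarrow> (real^'n \<Rightarrow> real) set" where
  "L2_on \<Omega> = {f \<in> borel_measurable (lebesgue_on \<Omega>). integrable (lebesgue_on \<Omega>) (\<lambda>x. (f x)\<^sup>2)}"

definition Linf_on :: "(real^'n) set \<Rightarrow> (real^'n \<Rightarrow> real) set" where
  "Linf_on \<Omega> = {f \<in> borel_measurable (lebesgue_on \<Omega>). \<exists>B. AE x in lebesgue_on \<Omega>. \<bar>f x\<bar> \<le> B}"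

definition bdist :: "(real^'n) set \<Rightarrow> real^'n \<Rightarrow> real" where
  "bdist \<Omega> x = infdist x (frontier \<Omega>)"

text \<open>Only meaningful for \<open>x \<noteq> y\<close>: the mathematical value on the diagonal is \<open>\<infinity>\<close>, the one below is \<open>0\<close>.\<close>

definition model_kernel :: "(real^'n) set \<Rightarrow> real \<Rightarrow> real \<Rightarrow> real^'n \<Rightarrow> real^'n \<Rightarrow> real" where
  "model_kernel \<Omega> s \<gamma> x y =
     1 / norm (x - y) powr (real CARD('n) - 2 * s)
       * (min (bdist \<Omega> x * bdist \<Omega> y / (norm (x - y))\<^sup>2) 1) powr \<gamma>"

definition green_op ::
  "(real^'n) set \<Rightarrow> (real^'n \<Rightarrow> real^'n \<Rightarrow> real) \<Rightarrow> (real^'n \<Rightarrow> real) \<Rightarrow> real^'n \<Rightarrow> real" where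
  "green_op \<Omega> G f x = (LINT y|lebesgue_on \<Omega>. G x y * f y)"

text \<open>
  The kernel is real-valued. This loses nothing: off the diagonal the upper bound forces
  finite values, and the values on the diagonal, where the two-sided bound is not imposed,
  do not affect \<open>green_op\<close>. Joint measurability is implicit in speaking of an integral kernel.
  In the last condition, belonging to \<open>C(closure \<Omega>)\<close> means extending continuously
  from \<open>\<Omega>\<close> to its closure.
\<close>

definition green_kernel ::
  "(real^'n) set \<Rightarrow> real \<Rightarrow> real \<Rightarrow> (real^'n \<Rightarrow> real^'n \<Rightarrow> real) \<Rightarrow> bool" where
  "green_kernel \<Omega> s \<gamma> G \<longleftrightarrow>
     (\<lambda>(x, y). G x y) \<in> borel_measurable (lebesgue_on (\<Omega> \<times> \<Omega>)) \<and>
     (\<forall>x\<in>\<Omega>. \<forall>y\<in>\<Omega>. G x y \<ge> 0) \<and>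
     (\<forall>x\<in>\<Omega>. \<forall>y\<in>\<Omega>. G x y = G y x) \<and>
     (\<exists>c C. 0 < c \<and> c \<le> C \<and>
        (\<forall>x\<in>\<Omega>. \<forall>y\<in>\<Omega>. x \<noteq> y \<longrightarrow>
           c * model_kernel \<Omega> s \<gamma> x y \<le> G x y \<and> G x y \<le> C * model_kernel \<Omega> s \<gamma> x y)) \<and>
     (\<forall>f\<in>L2_on \<Omega>. (LINT x|lebesgue_on \<Omega>. f x * green_op \<Omega> G f x) \<ge> 0) \<and>
     (\<forall>f\<in>Linf_on \<Omega>. \<exists>g. continuous_on (closure \<Omega>) g \<and> (\<forall>x\<in>\<Omega>. green_op \<Omega> G f x = g x))"

definition integral_solution ::
  "(real^'n) set \<Rightarrow> (real^'n \<Rightarrow> real^'n \<Rightarrow> real) \<Rightarrow> (real^'n \<Rightarrow> real) \<Rightarrow> (real^'n \<Rightarrow> real)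
     \<Rightarrow> (real^'n \<Rightarrow> real) \<Rightarrow> bool" where
  "integral_solution \<Omega> G V f u \<longleftrightarrow>
     integrable (lebesgue_on \<Omega>) u \<and>
     integrable (lebesgue_on \<Omega>) (\<lambda>x. V x * u x) \<and>
     (AE x in lebesgue_on \<Omega>. u x = green_op \<Omega> G (\<lambda>y. f y - V y * u y) x)"

end

theory Submission
  imports Defs
begin

text \<open>
  Two solutions \<open>u\<close>, \<open>v\<close> have a difference \<open>w\<close> satisfying \<open>w = - \<G>(V w)\<close>. If \<open>h = V w\<close> is square
  integrable, positivity of \<open>\<G>\<close> on \<open>L\<^sup>2\<close> finishes the proof at once:
  \<open>0 \<le> \<integral> h \<G>(h) = - \<integral> V w\<^sup>2\<close>, so \<open>V w\<^sup>2 = 0\<close> because \<open>V \<ge> 0\<close>, hence \<open>h = 0\<close> and \<open>w = - \<G>(h) = 0\<close>.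

  A priori \<open>w\<close> and \<open>V w\<close> are only in \<open>L\<^sup>1\<close>, so the work lies in showing that \<open>w\<close> is bounded. The upper
  bound on the kernel and the boundedness of \<open>V\<close> give
  \<open>\<bar>w x\<bar> \<le> A \<integral> \<bar>x - y\<bar>\<^sup>-\<^sup>a \<bar>w y\<bar> dy\<close> with \<open>a = n - 2 s < n\<close>. Instead of climbing through the \<open>L\<^sup>p\<close> scale,
  the kernel is split at a small distance \<open>r\<close>. The part with \<open>\<bar>x - y\<bar> > r\<close> is bounded and maps \<open>L\<^sup>1\<close> to
  a constant \<open>c\<close>; the part with \<open>\<bar>x - y\<bar> \<le> r\<close> has row and column masses of order \<open>r\<^sup>n\<^sup>-\<^sup>a\<close>
  (lemma \<open>nn_integral_riesz_kernel_cball\<close>), so at most one half for a suitable \<open>r\<close>. An integrable function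
  dominated by its image under such a near part plus \<open>c\<close> is at most \<open>2 c\<close>, because the excess over
  \<open>2 c\<close> is dominated by its own image, whose integral is at most half as large
  (lemma \<open>AE_le_of_le_small_kernel\<close>).

  The passage to the difference \<open>w\<close> needs the integrals defining \<open>\<G>\<close> to converge absolutely for almost
  every \<open>x\<close>; this follows from Tonelli's theorem for the dominating kernel \<open>\<bar>x - y\<bar>\<^sup>-\<^sup>a\<close>
  (lemma \<open>AE_integrable_weakly_singular\<close>).
\<close>

section \<open>Integral kernels with small row and column masses\<close>

lemma (in pair_sigma_finite) nn_integral_kernel_le_column_mass:
  fixes k :: "'a \<Rightarrow> 'b \<Rightarrow> ennreal"
  assumes k: "(\<lambda>(x, y). k x y) \<in> borel_measurable (M1 \<Otimes>\<^sub>M M2)"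
    and h: "h \<in> borel_measurable M2"
    and col: "\<And>y. y \<in> space M2 \<Longrightarrow> (\<integral>\<^sup>+x. k x y \<partial>M1) \<le> c"
  shows "(\<integral>\<^sup>+x. (\<integral>\<^sup>+y. k x y * h y \<partial>M2) \<partial>M1) \<le> c * (\<integral>\<^sup>+y. h y \<partial>M2)"
proof -
  note [measurable] = k h
  have kh: "(\<lambda>(x, y). k x y * h y) \<in> borel_measurable (M1 \<Otimes>\<^sub>M M2)"
    by measurable
  have "(\<integral>\<^sup>+x. (\<integral>\<^sup>+y. k x y * h y \<partial>M2) \<partial>M1) = (\<integral>\<^sup>+y. (\<integral>\<^sup>+x. k x y * h y \<partial>M1) \<partial>M2)"
    using Fubini'[OF kh] by simp
  also have "\<dots> = (\<integral>\<^sup>+y. (\<integral>\<^sup>+x. k x y \<partial>M1) * h y \<partial>M2)"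
    by (intro nn_integral_cong nn_integral_multc) measurable
  also have "\<dots> \<le> (\<integral>\<^sup>+y. c * h y \<partial>M2)"
    by (intro nn_integral_mono mult_right_mono col) auto
  also have "\<dots> = c * (\<integral>\<^sup>+y. h y \<partial>M2)"
    by (intro nn_integral_cmult h)
  finally show ?thesis .
qed

text \<open>
  The row bound sends the constant \<open>2 c\<close> to at most \<open>c\<close>, so subtracting \<open>2 c\<close> from \<open>w\<close> absorbs the
  inhomogeneity: the excess \<open>\<phi> = (w - 2 c)\<^sup>+\<close> satisfies \<open>\<phi> \<le> \<integral> k \<phi>\<close>. The column bound then gives
  \<open>\<integral> \<phi> \<le> 1/2 \<integral> \<phi>\<close>, which forces \<open>\<phi> = 0\<close> since \<open>\<integral> \<phi>\<close> is finite.
\<close>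

lemma AE_le_of_le_small_kernel:
  fixes k :: "'a \<Rightarrow> 'a \<Rightarrow> ennreal" and w :: "'a \<Rightarrow> ennreal" and c :: real
  assumes "sigma_finite_measure M"
    and k: "(\<lambda>(x, y). k x y) \<in> borel_measurable (M \<Otimes>\<^sub>M M)"
    and w: "w \<in> borel_measurable M" and fin: "(\<integral>\<^sup>+x. w x \<partial>M) < \<infinity>"
    and col: "\<And>y. y \<in> space M \<Longrightarrow> (\<integral>\<^sup>+x. k x y \<partial>M) \<le> ennreal (1/2)"
    and row: "\<And>x. x \<in> space M \<Longrightarrow> (\<integral>\<^sup>+y. k x y \<partial>M) \<le> ennreal (1/2)"
    and c: "0 \<le> c"
    and le: "AE x in M. w x \<le> (\<integral>\<^sup>+y. k x y * w y \<partial>M) + ennreal c"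
  shows "AE x in M. w x \<le> ennreal (2 * c)"
proof -
  interpret sigma_finite_measure M by fact
  interpret pair_sigma_finite M M ..
  note [measurable] = k w
  \<comment> \<open>Subtraction on \<^typ>\<open>ennreal\<close> truncates, so this is the positive part.\<close>
  define \<phi> where "\<phi> x = w x - ennreal (2 * c)" for x
  have \<phi>[measurable]: "\<phi> \<in> borel_measurable M" unfolding \<phi>_def by measurable
  have w_le: "w x \<le> \<phi> x + ennreal (2 * c)" for x
    unfolding \<phi>_def by (metis ennreal_minus_le_iff order_refl add.commute ennreal_neq_top)
  have "AE x in M. \<phi> x \<le> (\<integral>\<^sup>+y. k x y * \<phi> y \<partial>M)"
    using le AE_space
  proof eventually_elim
    case (elim x)
    note [measurable] = measurable_compose[OF measurable_Pair1'[OF elim(2)] k, simplified]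
    have "(\<integral>\<^sup>+y. k x y * w y \<partial>M) \<le> (\<integral>\<^sup>+y. k x y * \<phi> y + k x y * ennreal (2 * c) \<partial>M)"
      using w_le by (intro nn_integral_mono) (auto simp: distrib_left[symmetric] intro!: mult_left_mono)
    also have "\<dots> = (\<integral>\<^sup>+y. k x y * \<phi> y \<partial>M) + (\<integral>\<^sup>+y. k x y \<partial>M) * ennreal (2 * c)"
      by (subst nn_integral_add) (simp_all add: nn_integral_multc)
    also have "\<dots> \<le> (\<integral>\<^sup>+y. k x y * \<phi> y \<partial>M) + ennreal (1/2) * ennreal (2 * c)"
      by (intro add_left_mono mult_right_mono row elim) auto
    also have "ennreal (1/2) * ennreal (2 * c) = ennreal c"
      using c by (subst ennreal_mult[symmetric]) auto
    finally have "w x \<le> (\<integral>\<^sup>+y. k x y * \<phi> y \<partial>M) + ennreal c + ennreal c"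
      using elim(1) by (meson add_right_mono order_trans)
    also have "\<dots> = ennreal (2 * c) + (\<integral>\<^sup>+y. k x y * \<phi> y \<partial>M)"
      using c by (simp add: ac_simps flip: ennreal_plus)
    finally show ?case
      unfolding \<phi>_def by (subst ennreal_minus_le_iff) auto
  qed
  then have "(\<integral>\<^sup>+x. \<phi> x \<partial>M) \<le> (\<integral>\<^sup>+x. (\<integral>\<^sup>+y. k x y * \<phi> y \<partial>M) \<partial>M)"
    by (rule nn_integral_mono_AE)
  also have "\<dots> \<le> ennreal (1/2) * (\<integral>\<^sup>+y. \<phi> y \<partial>M)"
    by (intro nn_integral_kernel_le_column_mass k col) auto
  finally have half: "(\<integral>\<^sup>+x. \<phi> x \<partial>M) \<le> ennreal (1/2) * (\<integral>\<^sup>+y. \<phi> y \<partial>M)" .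
  have "(\<integral>\<^sup>+x. \<phi> x \<partial>M) \<le> (\<integral>\<^sup>+x. w x \<partial>M)"
    by (intro nn_integral_mono) (auto simp: \<phi>_def diff_le_self_ennreal)
  then have "(\<integral>\<^sup>+x. \<phi> x \<partial>M) < \<infinity>"
    using fin by (rule le_less_trans)
  then obtain t where t: "t \<ge> 0" "(\<integral>\<^sup>+x. \<phi> x \<partial>M) = ennreal t"
    by (cases "\<integral>\<^sup>+x. \<phi> x \<partial>M") auto
  have "ennreal t \<le> ennreal (1/2 * t)"
    using half t(1) unfolding t(2) by (subst ennreal_mult) auto
  then have "t = 0"
    using t(1) by (subst (asm) ennreal_le_iff) auto
  then have "AE x in M. \<phi> x = 0"
    using t by (simp add: nn_integral_0_iff_AE)
  then show ?thesis
  proof eventually_elim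
    case (elim x)
    then show ?case using w_le[of x] by simp
  qed
qed

section \<open>The Riesz kernel on small balls\<close>

text \<open>
  On the dyadic shell \<open>r / 2\<^sup>k\<^sup>+\<^sup>1 < \<bar>x - c\<bar> \<le> r / 2\<^sup>k\<close> the integrand is at most \<open>(2\<^sup>k\<^sup>+\<^sup>1 / r)\<^sup>a\<close>, and the shell
  lies in a ball of volume proportional to \<open>(r / 2\<^sup>k)\<^sup>n\<close>. The contributions form a geometric series with
  ratio \<open>2\<^sup>a\<^sup>-\<^sup>n < 1\<close>. What matters later is that the power of \<open>r\<close> is positive, so that small balls
  carry little mass, uniformly in their centre.
\<close>

lemma nn_integral_riesz_kernel_cball:
  fixes a :: real
  assumes a: "0 \<le> a" "a < DIM('a)"
  obtains K where "0 \<le> K"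
    and "\<And>(c::'a::euclidean_space) r. 0 < r \<Longrightarrow>
      (\<integral>\<^sup>+x. ennreal (1 / norm (x - c) powr a) * indicator (cball c r) x \<partial>lborel)
        \<le> ennreal (K * r powr (DIM('a) - a))"
proof -
  let ?n = "DIM('a)"
  define \<omega> where "\<omega> = unit_ball_vol ?n"
  define q :: real where "q = 2 powr (a - ?n)"
  have \<omega>: "0 \<le> \<omega>" unfolding \<omega>_def by simp
  have q: "0 < q" "q < 1" using a unfolding q_def by (auto simp: powr_less_one)
  define K where "K = \<omega> * 2 powr a / (1 - q)"
  show thesis
  proof
    show "0 \<le> K" unfolding K_def using \<omega> q by simp
    fix c :: 'a and r :: real
    assume r: "0 < r"
    define b where "b k = (2 ^ Suc k / r) powr a" for k
    have shell: "ennreal (1 / norm (x - c) powr a) * indicator (cball c r) x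
        \<le> (\<Sum>k. ennreal (b k) * indicator (cball c (r / 2 ^ k)) x)" for x
    proof (cases "x \<noteq> c \<and> x \<in> cball c r")
      case True
      define t where "t = norm (x - c) / r"
      have t: "0 < t" "t \<le> 1"
        using True r by (auto simp: t_def dist_norm norm_minus_commute)
      \<comment> \<open>The index of the shell containing \<open>x\<close> is the predecessor of the least \<open>m\<close> with \<open>r / 2\<^sup>m < \<bar>x - c\<bar>\<close>.\<close>
      define m where "m = (LEAST m. (1/2::real) ^ m < t)"
      have m: "(1/2) ^ m < t"
        unfolding m_def using real_arch_pow_inv[of t "1/2"] t by (auto intro: LeastI_ex)
      then obtain k where k: "m = Suc k"
        using t by (cases m) auto
      then have "\<not> (1/2) ^ k < t"
        using not_less_Least[of k "\<lambda>m. (1/2::real) ^ m < t"] by (simp add: m_def)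
      then have inside: "x \<in> cball c (r / 2 ^ k)"
        using r by (auto simp: t_def dist_norm norm_minus_commute field_simps)
      have "r / 2 ^ Suc k < norm (x - c)"
        using m r unfolding k t_def by (simp add: field_simps)
      then have "(r / 2 ^ Suc k) powr a \<le> norm (x - c) powr a"
        using a r by (intro powr_mono2) auto
      then have "1 / norm (x - c) powr a \<le> 1 / (r / 2 ^ Suc k) powr a"
        using r by (intro divide_left_mono) (auto intro!: mult_pos_pos simp: True)
      also have "\<dots> = b k"
        using r by (simp add: b_def powr_divide)
      finally have "ennreal (1 / norm (x - c) powr a) * indicator (cball c r) x
          \<le> ennreal (b k) * indicator (cball c (r / 2 ^ k)) x"
        using inside by (auto simp: indicator_def intro: ennreal_leI)
      also have "\<dots> = (\<Sum>i\<in>{k}. ennreal (b i) * indicator (cball c (r / 2 ^ i)) x)"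
        by (subst sum.insert) auto
      also have "\<dots> \<le> (\<Sum>k. ennreal (b k) * indicator (cball c (r / 2 ^ k)) x)"
        by (intro sum_le_suminf) auto
      finally show ?thesis .
      \<comment> \<open>At the centre the left side is \<open>0\<close> because \<open>0 powr a = 0\<close> and \<open>1 / 0 = 0\<close>.\<close>
    qed auto
    have mass: "b k * (\<omega> * (r / 2 ^ k) ^ ?n) = \<omega> * 2 powr a * r powr (?n - a) * q ^ k" for k
    proof -
      have "b k = 2 powr a * 2 powr (a * k) / r powr a"
        using r by (simp add: b_def powr_divide powr_mult powr_powr mult.commute flip: powr_realpow)
      moreover have "(r / 2 ^ k) ^ ?n = r powr ?n / 2 powr (?n * k)"
        using r by (simp add: power_divide powr_realpow[symmetric] powr_powr mult.commute)
      moreover have "q ^ k = 2 powr (a * k) / 2 powr (?n * k)"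
        using q(1) by (simp add: q_def powr_powr powr_diff[symmetric] algebra_simps flip: powr_realpow)
      moreover have "r powr (?n - a) = r powr ?n / r powr a"
        by (rule powr_diff)
      ultimately show ?thesis by simp
    qed
    have "(\<integral>\<^sup>+x. ennreal (1 / norm (x - c) powr a) * indicator (cball c r) x \<partial>lborel)
        \<le> (\<integral>\<^sup>+x. (\<Sum>k. ennreal (b k) * indicator (cball c (r / 2 ^ k)) x) \<partial>lborel)"
      by (intro nn_integral_mono shell)
    also have "\<dots> = (\<Sum>k. (\<integral>\<^sup>+x. ennreal (b k) * indicator (cball c (r / 2 ^ k)) x \<partial>lborel))"
      by (intro nn_integral_suminf borel_measurable_times_ennreal borel_measurable_indicator) auto
    also have "\<dots> = (\<Sum>k. ennreal (\<omega> * 2 powr a * r powr (?n - a) * q ^ k))"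
      using r by (intro suminf_cong, subst mass[symmetric])
        (simp add: nn_integral_cmult_indicator emeasure_cball \<omega>_def ennreal_mult' b_def)
    also have "\<dots> = ennreal (\<omega> * 2 powr a * r powr (?n - a) * (1 / (1 - q)))"
      using \<omega> q by (intro suminf_ennreal_eq sums_mult geometric_sums) auto
    also have "\<omega> * 2 powr a * r powr (?n - a) * (1 / (1 - q)) = K * r powr (?n - a)"
      by (simp add: K_def)
    finally show "(\<integral>\<^sup>+x. ennreal (1 / norm (x - c) powr a) * indicator (cball c r) x \<partial>lborel)
        \<le> ennreal (K * r powr (?n - a))" .
  qed
qed

section \<open>Lebesgue measurability\<close>

lemma borel_measurable_lebesgue_on_AE:
  fixes f g :: "'a::euclidean_space \<Rightarrow> real"
  assumes S: "S \<in> sets lebesgue"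
    and f: "f \<in> borel_measurable (lebesgue_on S)"
    and eq: "AE x in lebesgue_on S. f x = g x"
  shows "g \<in> borel_measurable (lebesgue_on S)"
proof -
  have "(\<lambda>x. if x \<in> S then f x else 0) \<in> borel_measurable lebesgue"
    using f S by (simp add: borel_measurable_if)
  moreover have "AE x in lebesgue. (if x \<in> S then f x else 0) = (if x \<in> S then g x else 0)"
    using eq S by (auto simp: AE_restrict_space_iff)
  ultimately have "(\<lambda>x. if x \<in> S then g x else 0) \<in> borel_measurable lebesgue"
    by (rule borel_measurable_AE)
  then show ?thesis
    using S by (simp add: borel_measurable_if)
qed

text \<open>
  A Lebesgue measurable function on a product agrees almost everywhere with a Borel function, whose
  sections are Borel; by Fubini almost every section of the exceptional null set is null. Some
  sections can fail to be measurable, since Lebesgue measure on the product is a completion.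
\<close>

lemma AE_section_measurable:
  fixes G :: "'a::euclidean_space \<Rightarrow> 'b::euclidean_space \<Rightarrow> real"
  assumes S: "S \<in> sets borel" and T: "T \<in> sets borel"
    and G: "(\<lambda>(x, y). G x y) \<in> borel_measurable (lebesgue_on (S \<times> T))"
  shows "AE x in lebesgue_on S. G x \<in> borel_measurable (lebesgue_on T)"
proof -
  have ST: "S \<times> T \<in> sets lebesgue"
    using S T by (intro sets_completionI_sets) (auto intro!: pair_measureI simp flip: lborel_prod)
  define E where "E p = (if p \<in> S \<times> T then (\<lambda>(x, y). G x y) p else 0)" for p
  have "E \<in> borel_measurable lebesgue"
    unfolding E_def using G ST by (simp add: borel_measurable_if)
  then obtain g where g: "g \<in> borel_measurable lborel" and "AE p in lborel. E p = g p"
    using completion_ex_borel_measurable_real by blast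
  then have "AE p in lborel \<Otimes>\<^sub>M lborel. E p = g p"
    by (subst lborel_prod)
  then have "AE x in lborel. AE y in lborel. E (x, y) = g (x, y)"
    by (rule lborel_pair.AE_pair)
  then have "AE x in lebesgue. x \<in> S \<longrightarrow> G x \<in> borel_measurable (lebesgue_on T)"
  proof (intro AE_completion, eventually_elim)
    case (elim x)
    have gx: "(\<lambda>y. g (x, y)) \<in> borel_measurable lborel"
      using g by (intro measurable_compose[OF measurable_Pair1' g[unfolded lborel_prod[symmetric]]]) auto
    have "(\<lambda>y. E (x, y)) \<in> borel_measurable lebesgue"
      by (rule borel_measurable_AE[of "\<lambda>y. g (x, y)"])
        (use gx elim in \<open>auto intro: measurable_completion AE_completion\<close>)
    then show ?case
      using T by (auto simp: E_def borel_measurable_if[symmetric])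
  qed
  then show ?thesis
    using S by (simp add: AE_restrict_space_iff)
qed


section \<open>Weakly singular kernels\<close>

lemma nn_integral_riesz_kernel_lebesgue_on:
  fixes a :: real
  assumes a: "0 \<le> a" "a < DIM('a)"
  obtains K where "0 \<le> K"
    and "\<And>S (c::'a::euclidean_space) r. S \<in> sets lebesgue \<Longrightarrow> 0 < r \<Longrightarrow>
      (\<integral>\<^sup>+x. ennreal (1 / norm (x - c) powr a) * indicator (cball c r) x \<partial>lebesgue_on S)
        \<le> ennreal (K * r powr (DIM('a) - a))"
proof -
  obtain K where K: "0 \<le> K"
    "\<And>(c::'a) r. 0 < r \<Longrightarrow>
      (\<integral>\<^sup>+x. ennreal (1 / norm (x - c) powr a) * indicator (cball c r) x \<partial>lborel)
        \<le> ennreal (K * r powr (DIM('a) - a))"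
    using nn_integral_riesz_kernel_cball[OF a] by blast
  show thesis
  proof (rule that[OF K(1)])
    fix S :: "'a set" and c :: 'a and r :: real
    assume S: "S \<in> sets lebesgue" and r: "0 < r"
    let ?k = "\<lambda>x. ennreal (1 / norm (x - c) powr a) * indicator (cball c r) x :: ennreal"
    have "(\<integral>\<^sup>+x. ?k x \<partial>lebesgue_on S) = (\<integral>\<^sup>+x. ?k x * indicator S x \<partial>lborel)"
      using S by (simp add: nn_integral_restrict_space nn_integral_completion)
    also have "\<dots> \<le> (\<integral>\<^sup>+x. ?k x \<partial>lborel)"
      by (intro nn_integral_mono) (auto simp: indicator_def)
    also have "\<dots> \<le> ennreal (K * r powr (DIM('a) - a))"
      using r by (rule K)
    finally show "(\<integral>\<^sup>+x. ?k x \<partial>lebesgue_on S) \<le> ennreal (K * r powr (DIM('a) - a))" .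
  qed
qed

lemma measurable_fst_lebesgue_on:
  "fst \<in> borel_measurable (lebesgue_on S \<Otimes>\<^sub>M N)"
  by (intro measurable_compose[OF measurable_fst] measurable_restrict_space1 measurable_completion)
    (simp add: measurable_ident)

lemma measurable_snd_lebesgue_on:
  "snd \<in> borel_measurable (N \<Otimes>\<^sub>M lebesgue_on S)"
  by (intro measurable_compose[OF measurable_snd] measurable_restrict_space1 measurable_completion)
    (simp add: measurable_ident)

lemma sigma_finite_lebesgue_on_bounded_open:
  assumes "open S" "bounded S"
  shows "sigma_finite_measure (lebesgue_on S)"
  using finite_measure_lebesgue_on[OF lmeasurable_open[OF assms(2,1)]]
  by (rule finite_measure.axioms(1)[rotated])

lemma AE_lebesgue_on_neq:
  fixes c :: "'a::euclidean_space"
  assumes "S \<in> sets lebesgue"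
  shows "AE x in lebesgue_on S. x \<noteq> c"
proof -
  have "AE x in lebesgue. x \<noteq> c"
    by (intro AE_completion AE_lborel_singleton)
  then show ?thesis
    using assms by (subst AE_restrict_space_iff) auto
qed

text \<open>
  The dominating kernel \<open>\<bar>x - y\<bar>\<^sup>-\<^sup>a\<close> has bounded column masses on a bounded set, as the whole set lies in
  one ball about each of its points. So its image of \<open>\<bar>h\<bar>\<close> has finite integral and is finite almost
  everywhere. Tonelli's theorem is applied to this Borel kernel only, as \<open>G\<close> itself need not be
  measurable for the product of the two Lebesgue measures.
\<close>

lemma AE_integrable_weakly_singular:
  fixes G :: "'a::euclidean_space \<Rightarrow> 'a \<Rightarrow> real" and a C :: real
  assumes S: "open S" "bounded S"
    and a: "0 \<le> a" "a < DIM('a)"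
    and G: "(\<lambda>(x, y). G x y) \<in> borel_measurable (lebesgue_on (S \<times> S))"
    and bound: "\<And>x y. x \<in> S \<Longrightarrow> y \<in> S \<Longrightarrow> x \<noteq> y \<Longrightarrow> \<bar>G x y\<bar> \<le> C * (1 / norm (x - y) powr a)"
    and h: "integrable (lebesgue_on S) h"
  shows "AE x in lebesgue_on S. integrable (lebesgue_on S) (\<lambda>y. G x y * h y)"
proof -
  let ?M = "lebesgue_on S"
  have leb: "S \<in> sets lebesgue" using S by auto
  interpret sigma_finite_measure ?M
    using S by (rule sigma_finite_lebesgue_on_bounded_open)
  interpret pair_sigma_finite ?M ?M ..
  note [measurable] = measurable_fst_lebesgue_on measurable_snd_lebesgue_on
    borel_measurable_integrable[OF h]
  define R where "R = diameter S + 1"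
  have R: "0 < R" "\<And>x y. x \<in> S \<Longrightarrow> y \<in> S \<Longrightarrow> dist x y \<le> R"
    using diameter_bounded_bound[OF S(2)] diameter_ge_0[OF S(2)] by (force simp: R_def)+
  obtain K where K: "0 \<le> K"
    "\<And>S (c::'a) r. S \<in> sets lebesgue \<Longrightarrow> 0 < r \<Longrightarrow>
      (\<integral>\<^sup>+x. ennreal (1 / norm (x - c) powr a) * indicator (cball c r) x \<partial>lebesgue_on S)
        \<le> ennreal (K * r powr (DIM('a) - a))"
    using nn_integral_riesz_kernel_lebesgue_on[OF a] by blast
  let ?k = "\<lambda>x y. ennreal (1 / norm (x - y) powr a)"
  have k[measurable]: "(\<lambda>(x, y). ?k x y) \<in> borel_measurable (?M \<Otimes>\<^sub>M ?M)"
    by measurable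
  have col: "(\<integral>\<^sup>+x. ?k x y \<partial>?M) \<le> ennreal (K * R powr (DIM('a) - a))" if "y \<in> space ?M" for y
  proof -
    have "(\<integral>\<^sup>+x. ?k x y \<partial>?M) = (\<integral>\<^sup>+x. ?k x y * indicator (cball y R) x \<partial>?M)"
      using that R(2) by (intro nn_integral_cong) (auto simp: indicator_def)
    then show ?thesis using K(2)[OF leb R(1), of y] by simp
  qed
  have "(\<integral>\<^sup>+x. (\<integral>\<^sup>+y. ?k x y * ennreal \<bar>h y\<bar> \<partial>?M) \<partial>?M)
      \<le> ennreal (K * R powr (DIM('a) - a)) * (\<integral>\<^sup>+y. ennreal \<bar>h y\<bar> \<partial>?M)"
    by (intro nn_integral_kernel_le_column_mass k col) auto
  also have "\<dots> < \<infinity>"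
    using h by (auto simp: integrable_iff_bounded ennreal_mult_less_top)
  finally have "AE x in ?M. (\<integral>\<^sup>+y. ?k x y * ennreal \<bar>h y\<bar> \<partial>?M) \<noteq> \<infinity>"
    by (intro nn_integral_PInf_AE) auto
  moreover have "AE x in ?M. G x \<in> borel_measurable ?M"
    using S G by (intro AE_section_measurable) auto
  ultimately show ?thesis
    using AE_space
  proof eventually_elim
    case (elim x)
    note [measurable] = elim(2)
    have kx[measurable]: "?k x \<in> borel_measurable ?M"
      using measurable_compose[OF measurable_Pair1'[OF elim(3)] k] by simp
    have "(\<integral>\<^sup>+y. ennreal (norm (G x y * h y)) \<partial>?M)
        \<le> (\<integral>\<^sup>+y. ennreal \<bar>C\<bar> * (?k x y * ennreal \<bar>h y\<bar>) \<partial>?M)"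
    proof (rule nn_integral_mono_AE)
      show "AE y in ?M. ennreal (norm (G x y * h y)) \<le> ennreal \<bar>C\<bar> * (?k x y * ennreal \<bar>h y\<bar>)"
        using AE_lebesgue_on_neq[OF leb, of x] AE_space
      proof eventually_elim
        case y: (elim y)
        have "\<bar>G x y\<bar> \<le> C * (1 / norm (x - y) powr a)"
          using elim(3) y by (intro bound) auto
        also have "\<dots> \<le> \<bar>C\<bar> * (1 / norm (x - y) powr a)"
          by (intro mult_right_mono) auto
        finally have "\<bar>G x y\<bar> * \<bar>h y\<bar> \<le> \<bar>C\<bar> * (1 / norm (x - y) powr a) * \<bar>h y\<bar>"
          by (rule mult_right_mono) auto
        then show ?case
          by (simp add: abs_mult mult.assoc ennreal_leI flip: ennreal_mult)
      qed
    qed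
    also have "\<dots> = ennreal \<bar>C\<bar> * (\<integral>\<^sup>+y. ?k x y * ennreal \<bar>h y\<bar> \<partial>?M)"
      by (intro nn_integral_cmult) measurable
    also have "\<dots> < \<infinity>"
      using elim(1) by (simp add: ennreal_mult_less_top less_top)
    finally show ?case
      by (intro integrableI_bounded) auto
  qed
qed

text \<open>
  Splitting the kernel at distance \<open>r\<close> replaces the usual iteration through \<open>L\<^sup>p\<close> spaces: the near part
  has small masses and is absorbed, the far part is a bounded kernel acting on an \<open>L\<^sup>1\<close> function.
\<close>

lemma AE_bounded_of_le_weakly_singular:
  fixes w :: "'a::euclidean_space \<Rightarrow> real" and a A :: real
  assumes S: "open S" "bounded S"
    and a: "0 \<le> a" "a < DIM('a)" and A: "0 \<le> A"
    and w: "integrable (lebesgue_on S) w"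
    and le: "AE x in lebesgue_on S. ennreal \<bar>w x\<bar>
        \<le> (\<integral>\<^sup>+y. ennreal (A / norm (x - y) powr a) * ennreal \<bar>w y\<bar> \<partial>lebesgue_on S)"
  obtains B where "0 \<le> B" "AE x in lebesgue_on S. \<bar>w x\<bar> \<le> B"
proof -
  let ?M = "lebesgue_on S"
  have leb: "S \<in> sets lebesgue" using S by auto
  note [measurable] = measurable_fst_lebesgue_on measurable_snd_lebesgue_on
    borel_measurable_integrable[OF w]
  obtain K where K: "0 \<le> K"
    "\<And>S (c::'a) r. S \<in> sets lebesgue \<Longrightarrow> 0 < r \<Longrightarrow>
      (\<integral>\<^sup>+x. ennreal (1 / norm (x - c) powr a) * indicator (cball c r) x \<partial>lebesgue_on S)
        \<le> ennreal (K * r powr (DIM('a) - a))"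
    using nn_integral_riesz_kernel_lebesgue_on[OF a] by blast
  \<comment> \<open>With \<open>1 / (2 A K)\<close> as the base the bound for the near masses would be \<open>1/2\<close>; the added \<open>1\<close> covers \<open>A K = 0\<close>.\<close>
  define r where "r = (1 / (2 * (A * K + 1))) powr (1 / (DIM('a) - a))"
  have pos: "0 < A * K + 1" using A K(1) by (simp add: add_nonneg_pos)
  then have r: "0 < r" by (simp add: r_def)
  have "A * (K * r powr (DIM('a) - a)) = A * K / (2 * (A * K + 1))"
    using a pos by (simp add: r_def powr_powr)
  also have "\<dots> \<le> 1/2"
    using pos by (simp add: field_simps)
  finally have small: "A * (K * r powr (DIM('a) - a)) \<le> 1/2" .
  let ?k = "\<lambda>x y. ennreal (A / norm (x - y) powr a)"
  define near where "near x y = ?k x y * indicator (cball y r) x" for x y :: 'a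
  have near: "(\<lambda>(x, y). near x y) \<in> borel_measurable (?M \<Otimes>\<^sub>M ?M)"
    unfolding near_def cball_def indicator_def by measurable
  have col: "(\<integral>\<^sup>+x. near x y \<partial>?M) \<le> ennreal (1/2)" for y
  proof -
    have "(\<integral>\<^sup>+x. near x y \<partial>?M)
        = (\<integral>\<^sup>+x. ennreal A * (ennreal (1 / norm (x - y) powr a) * indicator (cball y r) x) \<partial>?M)"
      unfolding near_def using A
      by (intro nn_integral_cong) (simp add: mult.assoc[symmetric] flip: ennreal_mult)
    also have "\<dots> = ennreal A *
        (\<integral>\<^sup>+x. ennreal (1 / norm (x - y) powr a) * indicator (cball y r) x \<partial>?M)"
      by (intro nn_integral_cmult measurable_restrict_space1 measurable_completion
          borel_measurable_times_ennreal borel_measurable_indicator) auto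
    also have "\<dots> \<le> ennreal A * ennreal (K * r powr (DIM('a) - a))"
      by (intro mult_left_mono K leb r) auto
    also have "\<dots> \<le> ennreal (1/2)"
      unfolding ennreal_mult'[OF A, symmetric] by (rule ennreal_leI[OF small])
    finally show ?thesis .
  qed
  have sym: "near x y = near y x" for x y
    by (simp add: near_def norm_minus_commute dist_commute indicator_def)
  define N where "N = (LINT y|?M. \<bar>w y\<bar>)"
  have N: "0 \<le> N" "(\<integral>\<^sup>+y. ennreal \<bar>w y\<bar> \<partial>?M) = ennreal N"
    using w unfolding N_def by (auto intro!: nn_integral_eq_integral)
  define c where "c = A / r powr a * N"
  have c: "0 \<le> c" using A N by (simp add: c_def)
  have far: "?k x y \<le> near x y + ennreal (A / r powr a)" for x y
  proof (cases "x \<in> cball y r")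
    case False
    then have "r powr a \<le> norm (x - y) powr a"
      using a r by (intro powr_mono2) (auto simp: dist_norm norm_minus_commute)
    then have "A / norm (x - y) powr a \<le> A / r powr a"
      using A r False by (intro divide_left_mono) (auto intro!: mult_pos_pos)
    then show ?thesis
      by (simp add: add_increasing ennreal_leI)
  qed (simp add: near_def)
  have "AE x in ?M. ennreal \<bar>w x\<bar> \<le> (\<integral>\<^sup>+y. near x y * ennreal \<bar>w y\<bar> \<partial>?M) + ennreal c"
    using le AE_space
  proof eventually_elim
    case (elim x)
    have [measurable]: "near x \<in> borel_measurable ?M"
      using measurable_compose[OF measurable_Pair1'[OF elim(2)] near] by simp
    have "ennreal \<bar>w x\<bar> \<le> (\<integral>\<^sup>+y. ?k x y * ennreal \<bar>w y\<bar> \<partial>?M)"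
      by (fact elim(1))
    also have "\<dots> \<le> (\<integral>\<^sup>+y. near x y * ennreal \<bar>w y\<bar>
        + ennreal (A / r powr a) * ennreal \<bar>w y\<bar> \<partial>?M)"
      using far by (intro nn_integral_mono) (auto simp: distrib_right[symmetric] intro!: mult_right_mono)
    also have "\<dots> = (\<integral>\<^sup>+y. near x y * ennreal \<bar>w y\<bar> \<partial>?M)
        + ennreal (A / r powr a) * (\<integral>\<^sup>+y. ennreal \<bar>w y\<bar> \<partial>?M)"
      by (subst nn_integral_add) (simp_all add: nn_integral_cmult)
    also have "ennreal (A / r powr a) * (\<integral>\<^sup>+y. ennreal \<bar>w y\<bar> \<partial>?M) = ennreal c"
      unfolding N(2) c_def using A N(1) by (intro ennreal_mult[symmetric]) auto
    finally show ?case .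
  qed
  moreover have "sigma_finite_measure ?M"
    using S by (rule sigma_finite_lebesgue_on_bounded_open)
  ultimately have "AE x in ?M. ennreal \<bar>w x\<bar> \<le> ennreal (2 * c)"
    using near col c N(2)
    by (intro AE_le_of_le_small_kernel[where k = near]) (auto simp: sym)
  then have "AE x in ?M. \<bar>w x\<bar> \<le> 2 * c"
    using c by (simp add: ennreal_le_iff)
  with c show thesis
    by (intro that[of "2 * c"]) auto
qed

lemma model_kernel_le:
  fixes \<Omega> :: "(real^'n) set"
  assumes "0 < \<gamma>"
  shows "model_kernel \<Omega> s \<gamma> x y \<le> 1 / norm (x - y) powr (real CARD('n) - 2 * s)"
proof -
  let ?m = "min (bdist \<Omega> x * bdist \<Omega> y / (norm (x - y))\<^sup>2) 1"
  have "0 \<le> ?m"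
    by (simp add: bdist_def infdist_nonneg)
  then have "?m powr \<gamma> \<le> 1 powr \<gamma>"
    using assms by (intro powr_mono2) auto
  then have "1 / norm (x - y) powr (real CARD('n) - 2 * s) * ?m powr \<gamma>
      \<le> 1 / norm (x - y) powr (real CARD('n) - 2 * s) * 1"
    by (intro mult_left_mono) auto
  then show ?thesis
    by (simp add: model_kernel_def)
qed

section \<open>Uniqueness\<close>

theorem theorem4p2:
  fixes \<Omega> :: "(real^'n) set" and s \<gamma> :: real
    and G :: "real^'n \<Rightarrow> real^'n \<Rightarrow> real"
    and V f u v :: "real^'n \<Rightarrow> real"
  assumes "CARD('n) \<ge> 3"
    and "0 < s" "s \<le> 1"
    and "0 < \<gamma>" "\<gamma> \<le> 1"
    and "open \<Omega>" "connected \<Omega>" "bounded \<Omega>" "\<Omega> \<noteq> {}"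
    and "green_kernel \<Omega> s \<gamma> G"
    and "V \<in> Linf_on \<Omega>" "AE x in lebesgue_on \<Omega>. V x \<ge> 0"
    and "integrable (lebesgue_on \<Omega>) f"
    and "integral_solution \<Omega> G V f u"
    and "integral_solution \<Omega> G V f v"
  shows "AE x in lebesgue_on \<Omega>. u x = v x"
proof -
  let ?M = "lebesgue_on \<Omega>"
  define a where "a = real CARD('n) - 2 * s"
  have a: "0 \<le> a" "a < DIM(real^'n)"
    using assms(1-3) by (auto simp: a_def)
  note S = \<open>open \<Omega>\<close> \<open>bounded \<Omega>\<close>
  have leb: "\<Omega> \<in> sets lebesgue" using S by auto
  interpret finite_measure ?M
    using S by (intro finite_measure_lebesgue_on lmeasurable_open)
  note G = \<open>green_kernel \<Omega> s \<gamma> G\<close>[unfolded green_kernel_def]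
  have G_meas: "(\<lambda>(x, y). G x y) \<in> borel_measurable (lebesgue_on (\<Omega> \<times> \<Omega>))"
    and G_nonneg: "\<And>x y. x \<in> \<Omega> \<Longrightarrow> y \<in> \<Omega> \<Longrightarrow> 0 \<le> G x y"
    and G_pos: "\<And>g. g \<in> L2_on \<Omega> \<Longrightarrow> 0 \<le> (LINT x|?M. g x * green_op \<Omega> G g x)"
    using G by blast+
  obtain c C where "0 < c" "c \<le> C"
    and C_le: "\<forall>x\<in>\<Omega>. \<forall>y\<in>\<Omega>. x \<noteq> y \<longrightarrow> c * model_kernel \<Omega> s \<gamma> x y \<le> G x y
      \<and> G x y \<le> C * model_kernel \<Omega> s \<gamma> x y"
    using G by blast
  then have C: "0 < C" "\<And>x y. x \<in> \<Omega> \<Longrightarrow> y \<in> \<Omega> \<Longrightarrow> x \<noteq> y \<Longrightarrow> G x y \<le> C * model_kernel \<Omega> s \<gamma> x y"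
    by auto
  have bound: "\<bar>G x y\<bar> \<le> C * (1 / norm (x - y) powr a)" if "x \<in> \<Omega>" "y \<in> \<Omega>" "x \<noteq> y" for x y
  proof -
    have "G x y \<le> C * (1 / norm (x - y) powr a)"
      using C(2)[OF that] model_kernel_le[OF \<open>0 < \<gamma>\<close>, of \<Omega> s x y] C(1)
      unfolding a_def by (meson less_imp_le mult_left_mono order_trans)
    then show ?thesis using G_nonneg that by simp
  qed
  have integrable_G: "AE x in ?M. integrable ?M (\<lambda>y. G x y * g y)" if "integrable ?M g" for g
    using that bound by (intro AE_integrable_weakly_singular[OF S a G_meas, where C = C]) auto
  obtain b where V: "V \<in> borel_measurable ?M" and "AE x in ?M. \<bar>V x\<bar> \<le> b"
    using \<open>V \<in> Linf_on \<Omega>\<close> by (auto simp: Linf_on_def)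
  then have Vb: "AE x in ?M. \<bar>V x\<bar> \<le> \<bar>b\<bar>"
    by (auto elim!: eventually_mono)
  have u: "integrable ?M u" "integrable ?M (\<lambda>x. V x * u x)"
      "AE x in ?M. u x = green_op \<Omega> G (\<lambda>y. f y - V y * u y) x"
    and v: "integrable ?M v" "integrable ?M (\<lambda>x. V x * v x)"
      "AE x in ?M. v x = green_op \<Omega> G (\<lambda>y. f y - V y * v y) x"
    using assms(14,15) by (auto simp: integral_solution_def)
  define w where "w x = u x - v x" for x
  define h where "h x = V x * w x" for x
  have w: "integrable ?M w"
    unfolding w_def using u v by auto
  have h: "integrable ?M h"
    unfolding h_def w_def using u v by (simp add: right_diff_distrib)
  note [measurable] = V borel_measurable_integrable[OF w] borel_measurable_integrable[OF h]
  \<comment> \<open>Linearity of \<open>\<G>\<close> is guaranteed only where both integrals converge, that is, almost everywhere.\<close>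
  have w_green: "AE x in ?M. w x = - green_op \<Omega> G h x"
    using u(3) v(3)
      integrable_G[OF Bochner_Integration.integrable_diff[OF \<open>integrable ?M f\<close> u(2)]]
      integrable_G[OF Bochner_Integration.integrable_diff[OF \<open>integrable ?M f\<close> v(2)]]
  proof eventually_elim
    case (elim x)
    have "w x = (LINT y|?M. G x y * (f y - V y * u y)) - (LINT y|?M. G x y * (f y - V y * v y))"
      unfolding w_def using elim(1,2) by (simp add: green_op_def)
    also have "\<dots> = (LINT y|?M. G x y * (f y - V y * u y) - G x y * (f y - V y * v y))"
      using elim(3,4) by (rule Bochner_Integration.integral_diff[symmetric])
    also have "\<dots> = (LINT y|?M. - (G x y * h y))"
      by (simp add: h_def w_def algebra_simps)
    finally show ?case
      by (simp add: green_op_def)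
  qed
  \<comment> \<open>Regularity: \<open>w\<close> is bounded, so that \<open>h\<close> is an admissible test function for the positivity of \<open>\<G>\<close>.\<close>
  have "AE x in ?M. ennreal \<bar>w x\<bar>
      \<le> (\<integral>\<^sup>+y. ennreal (C * \<bar>b\<bar> / norm (x - y) powr a) * ennreal \<bar>w y\<bar> \<partial>?M)"
    using w_green integrable_G[OF h] AE_space
  proof eventually_elim
    case (elim x)
    have "ennreal \<bar>w x\<bar> \<le> (\<integral>\<^sup>+y. ennreal (norm (G x y * h y)) \<partial>?M)"
      using integral_norm_bound_ennreal[OF elim(2)] elim(1) by (simp add: green_op_def)
    also have "\<dots> \<le> (\<integral>\<^sup>+y. ennreal (C * \<bar>b\<bar> / norm (x - y) powr a) * ennreal \<bar>w y\<bar> \<partial>?M)"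
    proof (rule nn_integral_mono_AE)
      show "AE y in ?M. ennreal (norm (G x y * h y))
          \<le> ennreal (C * \<bar>b\<bar> / norm (x - y) powr a) * ennreal \<bar>w y\<bar>"
        using AE_lebesgue_on_neq[OF leb, of x] Vb AE_space
      proof eventually_elim
        case y: (elim y)
        have "\<bar>G x y\<bar> * (\<bar>V y\<bar> * \<bar>w y\<bar>) \<le> C * (1 / norm (x - y) powr a) * (\<bar>b\<bar> * \<bar>w y\<bar>)"
          using elim(3) y C(1) by (intro mult_mono bound) auto
        then show ?case
          using C(1) by (simp add: h_def abs_mult ac_simps ennreal_leI flip: ennreal_mult)
      qed
    qed
    finally show ?case .
  qed
  then obtain B where B: "0 \<le> B" "AE x in ?M. \<bar>w x\<bar> \<le> B"
    using C(1) by (elim AE_bounded_of_le_weakly_singular[OF S a _ w, rotated]) auto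
  have hB: "AE x in ?M. \<bar>h x\<bar> \<le> \<bar>b\<bar> * B"
    using Vb B(2)
  proof eventually_elim
    case (elim x)
    then show ?case by (auto simp: h_def abs_mult intro!: mult_mono)
  qed
  have "integrable ?M (\<lambda>x. (h x)\<^sup>2)"
  proof (rule integrable_const_bound)
    show "AE x in ?M. norm ((h x)\<^sup>2) \<le> (\<bar>b\<bar> * B)\<^sup>2"
      using hB by eventually_elim (auto intro: power_mono simp: abs_le_square_iff[symmetric] power2_le_iff_abs_le B)
  qed measurable
  then have "h \<in> L2_on \<Omega>"
    by (simp add: L2_on_def)
  then have "0 \<le> (LINT x|?M. h x * green_op \<Omega> G h x)"
    by (rule G_pos)
  also have "\<dots> = (LINT x|?M. - (h x * w x))"
  proof (rule integral_cong_AE[symmetric])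
    show eq: "AE x in ?M. - (h x * w x) = h x * green_op \<Omega> G h x"
      using w_green by eventually_elim simp
    show "(\<lambda>x. h x * green_op \<Omega> G h x) \<in> borel_measurable ?M"
      by (rule borel_measurable_lebesgue_on_AE[OF leb _ eq]) measurable
  qed measurable
  finally have nonpos: "(LINT x|?M. h x * w x) \<le> 0"
    by simp
  have nonneg: "AE x in ?M. 0 \<le> h x * w x"
    using assms(12) by eventually_elim (simp add: h_def mult.assoc)
  have hw: "integrable ?M (\<lambda>x. h x * w x)"
  proof (rule integrable_const_bound)
    show "AE x in ?M. norm (h x * w x) \<le> \<bar>b\<bar> * B * B"
      using hB B(2) by eventually_elim (auto simp: abs_mult intro!: mult_mono)
  qed measurable
  have "AE x in ?M. h x * w x = 0"
    using nonpos integral_nonneg_AE[OF nonneg]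
    by (subst integral_nonneg_eq_0_iff_AE[OF hw nonneg, symmetric]) simp
  then have h0: "AE x in ?M. h x = 0"
    by eventually_elim (auto simp: h_def)
  have "green_op \<Omega> G h x = 0" for x
    unfolding green_op_def using h0 by (intro integral_eq_zero_AE) auto
  then show ?thesis
    using w_green by (auto simp: w_def)
qed

end
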